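(* Let $S$ be a finite set of non-zero integers with a choice of signs $\theta:S\to\{-1,1\}$, and let $f,d$ be integers with $1\le f\le d$ and $(f,d)=1$. Let $$C(S,\theta,d)=\sum_{T\in\mathcal{D}_i}\left(\frac{\mathrm{sqf}(T)}{f}\right)\theta(T),$$ where $i=2$ if $4\nmid d$, $i=1$ if $4\mid d$ and $8\nmid d$, and $i=0$ if $8\mid d$. Then $C(S,\theta,d)\ge 0$. Moreover: (i) if $4\nmid d$, then $C(S,\theta,d)>0$ if and only if $\theta(T)=\left(\frac{\mathrm{sqf}(T)}{f}\right)$ for every $T\in\mathcal{D}_2$; (ii) if $4\mid d$ and $8\nmid d$, then $C(S,\theta,d)>0$ if and only if $\theta(T)=\left(\frac{\mathrm{sqf}(T)}{f}\right)$ for every $T\in\mathcal{D}_1$; (iii) if $8\mid d$, then $C(S,\theta,d)>0$ if and only if $\theta(T)=\left(\frac{\mathrm{sqf}(T)}{f}\right)$ for every $T\in\mathcal{D}_0$.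
   Context: For a non-zero integer $n$, $\mathrm{sqf}(n)$ is its squarefree part: the unique squarefree integer $s$ (of the same sign as $n$) with $n=sm^2$ for some integer $m$. For a finite set $T$ of non-zero integers, $\mathrm{sqf}(T)=\mathrm{sqf}\left(\prod_{s\in T}s\right)$, and $\mathrm{sqf}(\emptyset)=1$. For $T\subseteq S$, $\theta(T)=\prod_{s\in T}\theta(s)$, with $\theta(\emptyset)=1$. For a positive integer $f$, $\left(\frac{\cdot}{f}\right)$ is the Jacobi symbol (Kronecker symbol if $f$ is even). Define $\mathcal{D}_0=\{T\subseteq S:\mathrm{sqf}(T)\mid d\}$, $\mathcal{D}_1=\{T\in\mathcal{D}_0:\mathrm{sqf}(T)\equiv 1\text{ or }3\ (\mathrm{mod}\ 4)\}$, $\mathcal{D}_2=\{T\in\mathcal{D}_0:\mathrm{sqf}(T)\equiv 1\ (\mathrm{mod}\ 4)\}$. The constant $C(S,\theta,d)$ also depends on $f$, although this is not displayed. *)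

theory Defs
  imports "HOL-Number_Theory.Number_Theory" "HOL-Computational_Algebra.Computational_Algebra"
begin

text \<open>
  On the integers, the square part of \<open>n\<close> in the library is non-negative, so that
  \<^const>\<open>squarefree_part\<close> carries the sign of \<open>n\<close>: it is the signed squarefree part \<open>sqf(n)\<close>.
\<close>

lemma squarefree_part_int_unique:
  fixes n s :: int
  assumes "n \<noteq> 0"
  shows "squarefree s \<and> (\<exists>m. n = s * m\<^sup>2) \<longleftrightarrow> s = squarefree_part n"
proof
  assume "s = squarefree_part n"
  then show "squarefree s \<and> (\<exists>m. n = s * m\<^sup>2)"
    using squarefree_decompose[of n] squarefree_squarefree_part[of n] by blast
next
  assume "squarefree s \<and> (\<exists>m. n = s * m\<^sup>2)"
  then obtain m where s: "squarefree s" and n: "n = s * m\<^sup>2" by blast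
  have s0: "s \<noteq> 0" and m0: "m \<noteq> 0" using assms n by auto
  have "normalize s = normalize (squarefree_part n)"
  proof (rule multiplicity_eq_imp_eq)
    fix p :: int assume p: "prime p"
    have "multiplicity p s \<le> 1"
      using s p s0 by (simp add: squarefree_factorial_semiring'')
    moreover have "multiplicity p n = multiplicity p s + 2 * multiplicity p m"
      using prime_imp_prime_elem[OF p] s0 m0
      by (simp only: n prime_elem_multiplicity_mult_distrib prime_elem_multiplicity_power_distrib
          power_not_zero not_False_eq_True)
    ultimately show "multiplicity p s = multiplicity p (squarefree_part n)"
      using p by (simp add: prime_multiplicity_squarefree_part)
  qed (use s0 in auto)
  then have "\<bar>s\<bar> = \<bar>squarefree_part n\<bar>" by simp
  moreover have "sgn s = sgn (squarefree_part n)"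
  proof -
    have sq: "sgn (x * y\<^sup>2) = sgn x" if "y \<noteq> 0" for x y :: int
    proof -
      have "sgn (y\<^sup>2) = 1" using that by (intro sgn_pos) simp
      then show ?thesis by (simp only: sgn_mult mult_1_right)
    qed
    have "sgn s = sgn n" using sq[OF m0] by (simp add: n)
    also have "\<dots> = sgn (squarefree_part n * (square_part n)\<^sup>2)"
      using squarefree_decompose[of n] by simp
    also have "\<dots> = sgn (squarefree_part n)"
      using assms by (intro sq) simp
    finally show ?thesis .
  qed
  ultimately show "s = squarefree_part n" by (metis sgn_mult_abs)
qed

definition sqf :: "int set \<Rightarrow> int" where
  "sqf T = squarefree_part (\<Prod>T)"

text \<open>
  The library's \<^const>\<open>Legendre\<close> symbol is not the Kronecker symbol at the prime 2, which is
  therefore treated separately.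
\<close>

definition kronecker_prime :: "int \<Rightarrow> int \<Rightarrow> int" where
  "kronecker_prime a p =
     (if p = 2 then (if even a then 0 else if a mod 8 \<in> {1, 7} then 1 else -1)
      else Legendre a p)"

text \<open>Only meant for a positive lower argument; it is the Jacobi symbol if \<open>f\<close> is odd.\<close>

definition kronecker_symbol :: "int \<Rightarrow> int \<Rightarrow> int" where
  "kronecker_symbol a f = (\<Prod>p\<in>#prime_factorization f. kronecker_prime a p)"

lemma kronecker_symbol_odd:
  assumes "odd f"
  shows "kronecker_symbol a f = (\<Prod>p\<in>#prime_factorization f. Legendre a p)"
  unfolding kronecker_symbol_def
proof (intro arg_cong[where f = prod_mset] image_mset_cong)
  fix p assume "p \<in># prime_factorization f"
  then have "p dvd f" by auto
  then have "p \<noteq> 2" using assms by auto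
  then show "kronecker_prime a p = Legendre a p" by (simp add: kronecker_prime_def)
qed

definition D0 :: "int set \<Rightarrow> int \<Rightarrow> int set set" where
  "D0 S d = {T. T \<subseteq> S \<and> sqf T dvd d}"

definition D1 :: "int set \<Rightarrow> int \<Rightarrow> int set set" where
  "D1 S d = {T \<in> D0 S d. [sqf T = 1] (mod 4) \<or> [sqf T = 3] (mod 4)}"

definition D2 :: "int set \<Rightarrow> int \<Rightarrow> int set set" where
  "D2 S d = {T \<in> D0 S d. [sqf T = 1] (mod 4)}"

definition sgn_prod :: "(int \<Rightarrow> int) \<Rightarrow> int set \<Rightarrow> int" where
  "sgn_prod \<theta> T = (\<Prod>s\<in>T. \<theta> s)"

definition C :: "int set \<Rightarrow> (int \<Rightarrow> int) \<Rightarrow> int \<Rightarrow> int \<Rightarrow> int" where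
  "C S \<theta> f d =
     (\<Sum>T\<in>(if \<not> 4 dvd d then D2 S d else if \<not> 8 dvd d then D1 S d else D0 S d).
        kronecker_symbol (sqf T) f * sgn_prod \<theta> T)"

end

theory Submission
  imports Defs
begin

text \<open>
  Each of the families \<open>D\<^sub>0\<close>, \<open>D\<^sub>1\<close>, \<open>D\<^sub>2\<close> is a subgroup of the group of subsets of \<open>S\<close> under symmetric
  difference, because \<open>sqf(T \<triangle> U) = sqf(T) sqf(U) / gcd(sqf(T), sqf(U))\<^sup>2\<close>. Since \<open>f\<close> is coprime to \<open>d\<close>,
  the summand is a character of that subgroup with values in \<open>{-1, 1}\<close>, so its sum is the order of
  the subgroup if the character is trivial, and \<open>0\<close> otherwise.
\<close>

section \<open>Sums of sign characters\<close>

lemma sum_sign_character: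
  fixes \<chi> :: "'a set \<Rightarrow> int"
  assumes "finite A" and "A \<noteq> {}"
    and closed: "\<And>T U. T \<in> A \<Longrightarrow> U \<in> A \<Longrightarrow> sym_diff T U \<in> A"
    and mult: "\<And>T U. T \<in> A \<Longrightarrow> U \<in> A \<Longrightarrow> \<chi> (sym_diff T U) = \<chi> T * \<chi> U"
    and sign: "\<And>T. T \<in> A \<Longrightarrow> \<chi> T \<in> {-1, 1}"
  shows "sum \<chi> A \<ge> 0" and "sum \<chi> A > 0 \<longleftrightarrow> (\<forall>T\<in>A. \<chi> T = 1)"
proof -
  have triv: "sum \<chi> A > 0" if "\<forall>T\<in>A. \<chi> T = 1"
    using that assms(1,2) by (simp add: card_gt_0_iff)
  have nontriv: "sum \<chi> A = 0" if ex: "\<not> (\<forall>T\<in>A. \<chi> T = 1)"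
  proof -
    obtain U where U: "U \<in> A" "\<chi> U = -1" using ex sign by blast
    have inv: "sym_diff (sym_diff T U) U = T" for T by blast
    \<comment> \<open>Translation by \<open>U\<close> is an involution of \<open>A\<close>, and it
      negates every value of the character; hence the sum equals its own negative.\<close>
    have "bij_betw (\<lambda>T. sym_diff T U) A A"
      by (rule bij_betw_byWitness[where f' = "\<lambda>T. sym_diff T U"])
        (use inv closed U in \<open>auto simp only: image_subset_iff\<close>)
    then have "sum \<chi> A = (\<Sum>T\<in>A. \<chi> (sym_diff T U))"
      by (rule sum.reindex_bij_betw[symmetric])
    also have "\<dots> = (\<Sum>T\<in>A. - \<chi> T)"
      by (rule sum.cong) (simp_all add: mult U)
    finally show ?thesis by (simp add: sum_negf)
  qed
  show "sum \<chi> A \<ge> 0" "sum \<chi> A > 0 \<longleftrightarrow> (\<forall>T\<in>A. \<chi> T = 1)"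
    using triv nontriv by force+
qed

section \<open>Squarefree parts of products\<close>

lemma squarefree_part_mult_square:
  fixes x k :: int
  assumes "x \<noteq> 0" and "k \<noteq> 0"
  shows "squarefree_part (x * k\<^sup>2) = squarefree_part x"
proof -
  obtain m where "x = squarefree_part x * m\<^sup>2"
    using squarefree_part_int_unique[OF assms(1)] by blast
  then have "x * k\<^sup>2 = squarefree_part x * (m * k)\<^sup>2"
    by (metis mult.assoc power_mult_distrib)
  moreover have "x * k\<^sup>2 \<noteq> 0" using assms by simp
  ultimately show ?thesis
    using squarefree_part_int_unique[of "x * k\<^sup>2" "squarefree_part x"]
      squarefree_squarefree_part[of x] by auto
qed

text \<open>Take \<open>g\<close> to be the gcd of the two squarefree parts. The cofactors are
  squarefree and coprime, so \<open>a * b\<close> is squarefree, while \<open>g\<close> joins the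
  square factor of \<open>x * y\<close>; uniqueness of the squarefree part finishes.\<close>

lemma squarefree_part_multE:
  fixes x y :: int
  assumes "x \<noteq> 0" and "y \<noteq> 0"
  obtains g a b where "squarefree_part x = g * a" and "squarefree_part y = g * b"
    and "squarefree_part (x * y) = a * b" and "coprime a b"
proof -
  let ?x = "squarefree_part x" and ?y = "squarefree_part y"
  have nz: "?x \<noteq> 0" "?y \<noteq> 0" using assms by auto
  define g where "g = gcd ?x ?y"
  obtain a b where ab: "?x = g * a" "?y = g * b" "coprime a b"
    using gcd_coprime_exists[of ?x ?y] nz unfolding g_def by (metis gcd_eq_0_iff mult.commute)
  obtain m where m: "x = ?x * m\<^sup>2" using squarefree_part_int_unique[OF assms(1)] by blast
  obtain n where n: "y = ?y * n\<^sup>2" using squarefree_part_int_unique[OF assms(2)] by blast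
  have "squarefree a" "squarefree b"
    using ab squarefree_squarefree_part[of x] squarefree_squarefree_part[of y]
    by (metis dvd_triv_right squarefree_mono)+
  then have "squarefree (a * b)" using ab by (simp add: squarefree_mult_coprime)
  moreover have "x * y = a * b * (g * m * n)\<^sup>2"
    by (subst m, subst n, simp add: ab power2_eq_square mult_ac)
  moreover have "x * y \<noteq> 0" using assms by simp
  ultimately have "squarefree_part (x * y) = a * b"
    using squarefree_part_int_unique[of "x * y" "a * b"] by auto
  then show ?thesis using that ab by blast
qed

text \<open>The common elements occur twice on the left. In this division-free form it serves both
  the product of the elements and the product of the signs.\<close>

lemma prod_sym_diff:
  fixes h :: "'a \<Rightarrow> 'b :: comm_monoid_mult"
  assumes "finite T" and "finite U"
  shows "prod h T * prod h U = prod h (sym_diff T U) * (prod h (T \<inter> U))\<^sup>2"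
proof -
  have "prod h (sym_diff T U) = prod h (T - U) * prod h (U - T)"
    using assms by (intro prod.union_disjoint) auto
  moreover have "prod h T = prod h (T - U) * prod h (T \<inter> U)"
    using prod.Int_Diff[OF assms(1), of h U] by (simp add: mult.commute)
  moreover have "prod h U = prod h (U - T) * prod h (T \<inter> U)"
    using prod.Int_Diff[OF assms(2), of h T] by (simp add: mult.commute Int_commute)
  ultimately show ?thesis by (simp add: power2_eq_square mult_ac)
qed

text \<open>The square of the product over \<open>T \<inter> U\<close> does not affect the
  squarefree part. Closure of the three families and multiplicativity of the symbol are all read off
  from this factorisation.\<close>

lemma sqf_sym_diffE:
  assumes "finite T" and "finite U" and "0 \<notin> T" and "0 \<notin> U"
  obtains g a b where "sqf T = g * a" and "sqf U = g * b"
    and "sqf (sym_diff T U) = a * b" and "coprime a b"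
proof -
  have nz: "\<Prod>T \<noteq> 0" "\<Prod>U \<noteq> 0" "\<Prod>(sym_diff T U) \<noteq> 0" "\<Prod>(T \<inter> U) \<noteq> 0"
    using assms by (simp_all add: prod_zero_iff)
  have "\<Prod>T * \<Prod>U = \<Prod>(sym_diff T U) * (\<Prod>(T \<inter> U))\<^sup>2"
    using assms(1,2) by (rule prod_sym_diff)
  then have "squarefree_part (\<Prod>T * \<Prod>U) = sqf (sym_diff T U)"
    using squarefree_part_mult_square nz by (simp add: sqf_def)
  then show ?thesis
    using squarefree_part_multE[OF nz(1,2)] that unfolding sqf_def by metis
qed

section \<open>Multiplicativity of the Kronecker symbol\<close>

lemma Legendre_mult:
  assumes "prime p" and "2 < p"
  shows "Legendre (a * b) p = Legendre a p * Legendre b p"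
proof -
  obtain q where q: "p = int q"
    using assms(2) by (intro that[of "nat p"]) simp
  define k where "k = (q - 1) div 2"
  have "prime q" "2 < q" using assms by (simp_all add: q)
  then have euler: "[Legendre x p = x ^ k] (mod p)" for x
    unfolding q k_def by (rule euler_criterion)
  have "[Legendre (a * b) p = Legendre a p * Legendre b p] (mod p)"
    using cong_trans[OF euler[of "a * b"]] cong_sym[OF cong_mult[OF euler[of a] euler[of b]]]
    by (simp add: power_mult_distrib)
  then have "p dvd Legendre (a * b) p - Legendre a p * Legendre b p"
    by (simp add: cong_iff_dvd_diff)
  \<comment> \<open>Both terms lie in {-1, 0, 1}, so they differ by at most 2, and congruence modulo
    \<open>p > 2\<close> becomes equality.\<close>
  moreover have "\<bar>Legendre (a * b) p - Legendre a p * Legendre b p\<bar> < p"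
    using assms by (auto simp: Legendre_def)
  ultimately have "Legendre (a * b) p - Legendre a p * Legendre b p = 0"
    using dvd_imp_le_int[of "Legendre (a * b) p - Legendre a p * Legendre b p" p] assms(2) by linarith
  then show ?thesis by simp
qed

lemma kronecker_prime_mult:
  assumes "prime p"
  shows "kronecker_prime (a * b) p = kronecker_prime a p * kronecker_prime b p"
proof (cases "p = 2")
  case True
  have *: "x mod 8 \<in> {1, 3, 5, 7}" if "odd x" for x :: int
    using that by simp presburger
  show ?thesis
  proof (cases "even a \<or> even b")
    case False
    \<comment> \<open>The symbol at 2 depends only on the residue modulo 8, which leaves sixteen
      pairs of odd residues to check.\<close>
    then have "a mod 8 \<in> {1, 3, 5, 7}" "b mod 8 \<in> {1, 3, 5, 7}" using * by auto
    moreover obtain r t where "a mod 8 = r" "b mod 8 = t" by blast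
    moreover from this have "(a * b) mod 8 = (r * t) mod 8" by (metis mod_mult_eq)
    ultimately show ?thesis
      using False True by (elim insertE emptyE) (simp_all add: kronecker_prime_def)
  qed (auto simp: kronecker_prime_def True)
next
  case False
  then have "2 < p" using prime_ge_2_int[OF assms] by simp
  with False assms show ?thesis by (simp add: kronecker_prime_def Legendre_mult)
qed

lemma kronecker_symbol_mult:
  "kronecker_symbol (a * b) f = kronecker_symbol a f * kronecker_symbol b f"
proof -
  have "kronecker_symbol (a * b) f
      = (\<Prod>p\<in>#prime_factorization f. kronecker_prime a p * kronecker_prime b p)"
    unfolding kronecker_symbol_def
    by (intro arg_cong[where f = prod_mset] image_mset_cong kronecker_prime_mult) auto
  then show ?thesis by (simp add: kronecker_symbol_def prod_mset.distrib)
qed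

text \<open>No prime factor of \<open>f\<close> divides \<open>a\<close>, so no local factor
  vanishes.\<close>

lemma kronecker_symbol_coprime:
  assumes "coprime a f"
  shows "kronecker_symbol a f \<in> {-1, 1}"
proof -
  have "kronecker_prime a p \<in> {-1, 1}" if "p \<in># prime_factorization f" for p
  proof -
    have "prime p" "p dvd f" using that by auto
    then have "\<not> p dvd a" using assms by (meson coprime_common_divisor not_prime_unit)
    then show ?thesis by (auto simp: kronecker_prime_def Legendre_def cong_0_iff)
  qed
  moreover have "(\<Prod>p\<in>#M. kronecker_prime a p) \<in> {-1, 1}"
    if "\<forall>p\<in>#M. kronecker_prime a p \<in> {-1, 1}" for M :: "int multiset"
    using that by (induction M) auto
  ultimately show ?thesis unfolding kronecker_symbol_def by blast
qed

section \<open>The three families of subsets\<close>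

lemma sgn_prod_sign:
  assumes "\<forall>s\<in>T. \<theta> s \<in> {-1, 1}"
  shows "sgn_prod \<theta> T \<in> {-1, 1}"
  using assms unfolding sgn_prod_def by (induction T rule: infinite_finite_induct) auto

lemma sgn_prod_sym_diff:
  assumes "finite T" and "finite U" and "\<forall>s\<in>T. \<theta> s \<in> {-1, 1}"
  shows "sgn_prod \<theta> (sym_diff T U) = sgn_prod \<theta> T * sgn_prod \<theta> U"
proof -
  have "(sgn_prod \<theta> (T \<inter> U))\<^sup>2 = 1"
    using sgn_prod_sign[of "T \<inter> U" \<theta>] assms(3) by auto
  then show ?thesis
    using prod_sym_diff[OF assms(1,2), of \<theta>] by (simp add: sgn_prod_def)
qed

lemma kronecker_symbol_sqf_sym_diff:
  assumes "finite T" and "finite U" and "0 \<notin> T" and "0 \<notin> U" and "coprime (sqf T) f"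
  shows "kronecker_symbol (sqf (sym_diff T U)) f
    = kronecker_symbol (sqf T) f * kronecker_symbol (sqf U) f"
proof -
  obtain g a b where eq: "sqf T = g * a" "sqf U = g * b" "sqf (sym_diff T U) = a * b"
    using sqf_sym_diffE[OF assms(1-4)] by metis
  \<comment> \<open>Since \<open>g\<close> divides \<open>sqf T\<close>, it is coprime to
    \<open>f\<close>; its symbol appears squared on the right-hand side and contributes 1.\<close>
  have "kronecker_symbol g f \<in> {-1, 1}"
    using assms(5) by (intro kronecker_symbol_coprime) (simp add: eq)
  then show ?thesis by (auto simp: eq kronecker_symbol_mult)
qed

text \<open>The cofactors \<open>a\<close> and \<open>b\<close> both divide \<open>d\<close>; being
  coprime, so does their product.\<close>

lemma D0_sym_diff:
  assumes "finite S" and "0 \<notin> S" and "T \<in> D0 S d" and "U \<in> D0 S d"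
  shows "sym_diff T U \<in> D0 S d"
proof -
  have TU: "T \<subseteq> S" "U \<subseteq> S" using assms by (auto simp: D0_def)
  then have "finite T" "finite U" "0 \<notin> T" "0 \<notin> U" using assms(1,2) finite_subset by auto
  then obtain g a b where "sqf T = g * a" "sqf U = g * b" "sqf (sym_diff T U) = a * b" "coprime a b"
    by (rule sqf_sym_diffE)
  moreover from this have "a dvd d" "b dvd d"
    using assms(3,4) by (auto simp: D0_def dest: dvd_mult_right)
  ultimately have "sqf (sym_diff T U) dvd d" by (simp add: divides_mult)
  then show ?thesis using TU by (auto simp: D0_def)
qed

lemma sqf_sym_diff_cong_4:
  assumes "finite T" and "finite U" and "0 \<notin> T" and "0 \<notin> U" and "odd (sqf T)"
  shows "[sqf (sym_diff T U) = sqf T * sqf U] (mod 4)"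
proof -
  obtain g a b where eq: "sqf T = g * a" "sqf U = g * b" "sqf (sym_diff T U) = a * b"
    using sqf_sym_diffE[OF assms(1-4)] by metis
  \<comment> \<open>The two sides of the congruence differ by the factor \<open>g * g\<close>, and
    the square of an odd number is 1 modulo 4.\<close>
  then obtain k where "g = 2 * k + 1" using assms(5) by (auto elim: oddE)
  then have "sqf T * sqf U - sqf (sym_diff T U) = 4 * ((k * k + k) * (a * b))"
    by (simp add: eq algebra_simps)
  then show ?thesis by (metis cong_iff_dvd_diff cong_sym dvd_triv_left)
qed

text \<open>With the residue condition read as oddness, closure only requires that the factors
  \<open>a\<close> and \<open>b\<close> of odd numbers are odd.\<close>

lemma D1_eq: "D1 S d = {T \<in> D0 S d. odd (sqf T)}"
proof -
  have "([x = 1] (mod 4) \<or> [x = 3] (mod 4)) \<longleftrightarrow> odd x" for x :: int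
    unfolding cong_def by simp presburger
  then show ?thesis by (simp add: D1_def)
qed

lemma D1_sym_diff:
  assumes "finite S" and "0 \<notin> S" and "T \<in> D1 S d" and "U \<in> D1 S d"
  shows "sym_diff T U \<in> D1 S d"
proof -
  have TU: "T \<in> D0 S d" "U \<in> D0 S d" "odd (sqf T)" "odd (sqf U)"
    using assms by (auto simp: D1_eq)
  then have "finite T" "finite U" "0 \<notin> T" "0 \<notin> U"
    using assms(1,2) finite_subset by (auto simp: D0_def)
  then obtain g a b where "sqf T = g * a" "sqf U = g * b" "sqf (sym_diff T U) = a * b"
    by (rule sqf_sym_diffE)
  then show ?thesis using TU D0_sym_diff[OF assms(1,2) TU(1,2)] by (simp add: D1_eq)
qed

lemma D2_sym_diff:
  assumes "finite S" and "0 \<notin> S" and "T \<in> D2 S d" and "U \<in> D2 S d"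
  shows "sym_diff T U \<in> D2 S d"
proof -
  have TU: "T \<in> D0 S d" "U \<in> D0 S d" "[sqf T = 1] (mod 4)" "[sqf U = 1] (mod 4)"
    using assms by (auto simp: D2_def)
  then have "finite T" "finite U" "0 \<notin> T" "0 \<notin> U"
    using assms(1,2) finite_subset by (auto simp: D0_def)
  moreover have "odd (sqf T)" using TU(3) unfolding cong_def by simp presburger
  ultimately have "[sqf (sym_diff T U) = sqf T * sqf U] (mod 4)"
    by (rule sqf_sym_diff_cong_4)
  also have "[sqf T * sqf U = 1 * 1] (mod 4)" using TU by (intro cong_mult)
  finally show ?thesis using D0_sym_diff[OF assms(1,2) TU(1,2)] by (simp add: D2_def)
qed

text \<open>The neutral element of the group; it makes all three families non-empty, as they contain
  \<open>D2 S d\<close>.\<close>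

lemma empty_in_D2: "{} \<in> D2 S d"
  using squarefree_part_int_unique[of 1 1] by (auto simp: D2_def D0_def sqf_def)

theorem lemma6:
  fixes S :: "int set" and \<theta> :: "int \<Rightarrow> int" and f d :: int
  assumes "finite S" and "0 \<notin> S"
    and "\<forall>s\<in>S. \<theta> s \<in> {-1, 1}"
    and "1 \<le> f" and "f \<le> d" and "coprime f d"
  shows "C S \<theta> f d \<ge> 0
    \<and> (\<not> 4 dvd d \<longrightarrow>
        (C S \<theta> f d > 0 \<longleftrightarrow> (\<forall>T\<in>D2 S d. sgn_prod \<theta> T = kronecker_symbol (sqf T) f)))
    \<and> (4 dvd d \<and> \<not> 8 dvd d \<longrightarrow>
        (C S \<theta> f d > 0 \<longleftrightarrow> (\<forall>T\<in>D1 S d. sgn_prod \<theta> T = kronecker_symbol (sqf T) f)))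
    \<and> (8 dvd d \<longrightarrow>
        (C S \<theta> f d > 0 \<longleftrightarrow> (\<forall>T\<in>D0 S d. sgn_prod \<theta> T = kronecker_symbol (sqf T) f)))"
proof -
  define \<chi> where "\<chi> T = kronecker_symbol (sqf T) f * sgn_prod \<theta> T" for T
  \<comment> \<open>Coprimality passes from \<open>d\<close> to its divisor
    \<open>sqf T\<close>.\<close>
  have sub: "finite T" "0 \<notin> T" "\<forall>s\<in>T. \<theta> s \<in> {-1, 1}" "coprime (sqf T) f" if "T \<in> D0 S d" for T
    using that assms finite_subset coprime_divisors[of "sqf T" d f f]
    by (auto simp: D0_def coprime_commute)
  have signs: "kronecker_symbol (sqf T) f \<in> {-1, 1}" "sgn_prod \<theta> T \<in> {-1, 1}"
    if "T \<in> D0 S d" for T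
    using sub[OF that] kronecker_symbol_coprime sgn_prod_sign by blast+
  have \<chi>_sign: "\<chi> T \<in> {-1, 1}" if "T \<in> D0 S d" for T
    using signs[OF that] by (auto simp: \<chi>_def)
  have \<chi>_1: "\<chi> T = 1 \<longleftrightarrow> sgn_prod \<theta> T = kronecker_symbol (sqf T) f" if "T \<in> D0 S d" for T
    using signs[OF that] by (auto simp: \<chi>_def)
  have \<chi>_mult: "\<chi> (sym_diff T U) = \<chi> T * \<chi> U" if "T \<in> D0 S d" "U \<in> D0 S d" for T U
    using kronecker_symbol_sqf_sym_diff[of T U f] sgn_prod_sym_diff[of T U \<theta>]
      sub[OF that(1)] sub[OF that(2)]
    by (simp add: \<chi>_def mult_ac)
  \<comment> \<open>One argument for every closed family between \<open>D2 S d\<close> and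
    \<open>D0 S d\<close>: the upper bound makes \<open>\<chi>\<close> a sign character on
    \<open>A\<close>, the lower bound puts the empty set into \<open>A\<close>.\<close>
  have main: "sum \<chi> A \<ge> 0 \<and>
      (sum \<chi> A > 0 \<longleftrightarrow> (\<forall>T\<in>A. sgn_prod \<theta> T = kronecker_symbol (sqf T) f))"
    if "A \<subseteq> D0 S d" "D2 S d \<subseteq> A"
      and closed: "\<And>T U. T \<in> A \<Longrightarrow> U \<in> A \<Longrightarrow> sym_diff T U \<in> A" for A
  proof -
    have "finite (D0 S d)" using assms(1) by (simp add: D0_def)
    then have "finite A" using that(1) by (rule rev_finite_subset)
    moreover have "A \<noteq> {}" using empty_in_D2 that(2) by blast
    moreover have "\<chi> (sym_diff T U) = \<chi> T * \<chi> U" if "T \<in> A" "U \<in> A" for T U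
      using that \<open>A \<subseteq> D0 S d\<close> by (intro \<chi>_mult) auto
    moreover have "\<chi> T \<in> {-1, 1}" if "T \<in> A" for T
      using that \<open>A \<subseteq> D0 S d\<close> by (intro \<chi>_sign) auto
    ultimately have "sum \<chi> A \<ge> 0" "sum \<chi> A > 0 \<longleftrightarrow> (\<forall>T\<in>A. \<chi> T = 1)"
      using closed sum_sign_character[of A \<chi>] by blast+
    then show ?thesis using \<chi>_1 that(1) by blast
  qed
  have sets: "D2 S d \<subseteq> D0 S d" "D2 S d \<subseteq> D1 S d" "D1 S d \<subseteq> D0 S d"
    by (auto simp: D1_def D2_def)
  have "C S \<theta> f d = sum \<chi> (if \<not> 4 dvd d then D2 S d else if \<not> 8 dvd d then D1 S d else D0 S d)"
    by (simp add: C_def \<chi>_def)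
  \<comment> \<open>This selects the last branch of the nested conditional when 8 divides
    \<open>d\<close>.\<close>
  moreover have "4 dvd d" if "8 dvd d" using that by presburger
  ultimately show ?thesis
    using main[OF sets(1) subset_refl D2_sym_diff[OF assms(1,2)]]
      main[OF sets(3,2) D1_sym_diff[OF assms(1,2)]]
      main[OF subset_refl sets(1) D0_sym_diff[OF assms(1,2)]]
    by auto
qed

end
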